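(* Let $c>0$ and $\Delta=(0,c]$. Suppose that $F\in\mathcal S_\Delta\cap\mathcal D_\Delta$ is a distribution on $\mathbb R$. Let $G_1,G_2$ be two distributions on $\mathbb R$ such that $G_1(x+\Delta)/F(x+\Delta)\to c_1$ and $G_2(x+\Delta)/F(x+\Delta)\to c_2$ as $x\to\infty$ for some constants $c_1,c_2\ge0$. Then $$\frac{G_1*G_2(x+\Delta)}{F(x+\Delta)}\to c_1+c_2\quad\text{as }x\to\infty.$$ Further, if $c_1+c_2>0$, then $G_1*G_2\in\mathcal S_\Delta$.
   Context: For $\Delta=(0,c]$ and a distribution $F$ on $\mathbb R$, $F(x+\Delta):=F((x,x+c])$. $F*G$ is the convolution and $F^{*n}$ the $n$-fold convolution. $\alpha(x)\sim\beta(x)$ means $\alpha(x)/\beta(x)\to1$ as $x\to\infty$. A non-negative measurable function $\alpha$ belongs to $\mathcal L$ if there is $x_0>0$ with $\alpha(x)>0$ for $x\ge x_0$ and, for every fixed $y>0$, $\alpha(x+y)\sim\alpha(x)$. $F\in\mathcal L_\Delta$ if $x\mapsto F(x+\Delta)$ is in $\mathcal L$; $F\in\mathcal S_\Delta$ if $F\in\mathcal L_\Delta$ and $F^{*2}(x+\Delta)\sim 2F(x+\Delta)$. A function $\alpha:\mathbb R\to\mathbb R_+$ is almost decreasing if there exist $x_0>0$ and $K>0$ such that $\alpha(x+y)\le K\alpha(x)$ for all $x>x_0$, $y>0$. $F\in\mathcal D_\Delta$ if $x\mapsto F(x+\Delta)$ is almost decreasing. *)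

theory Defs
  imports "HOL-Probability.Probability"
begin

text \<open>Distributions on the real line are \<^locale>\<open>real_distribution\<close> measures. The parameter
  \<open>c\<close> stands for \<open>\<Delta> = (0,c]\<close>, so \<open>local_prob c F x\<close> is \<open>F(x + \<Delta>)\<close>.\<close>

definition local_prob :: "real \<Rightarrow> real measure \<Rightarrow> real \<Rightarrow> real" where
  "local_prob c F x = measure F {x<..x + c}"

text \<open>In both definitions below that use \<^const>\<open>asymp_equiv\<close>, the right-hand function is eventually
  positive, so its convention \<open>0/0 = 1\<close> never matters and it says that the quotient tends to 1.\<close>

definition long_tailed_fun :: "(real \<Rightarrow> real) set" where
  "long_tailed_fun = {\<alpha>. \<alpha> \<in> borel_measurable borel \<and> (\<forall>x. 0 \<le> \<alpha> x) \<and>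
     (\<exists>x0>0. \<forall>x\<ge>x0. 0 < \<alpha> x) \<and> (\<forall>y>0. (\<lambda>x. \<alpha> (x + y)) \<sim>[at_top] \<alpha>)}"

definition almost_decreasing :: "(real \<Rightarrow> real) \<Rightarrow> bool" where
  "almost_decreasing \<alpha> \<longleftrightarrow> (\<forall>x. 0 \<le> \<alpha> x) \<and>
     (\<exists>x0>0. \<exists>K>0. \<forall>x>x0. \<forall>y>0. \<alpha> (x + y) \<le> K * \<alpha> x)"

definition L_Delta :: "real \<Rightarrow> real measure set" where
  "L_Delta c = {F. real_distribution F \<and> local_prob c F \<in> long_tailed_fun}"

definition S_Delta :: "real \<Rightarrow> real measure set" where
  "S_Delta c = {F \<in> L_Delta c. local_prob c (F \<star> F) \<sim>[at_top] (\<lambda>x. 2 * local_prob c F x)}"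

definition D_Delta :: "real \<Rightarrow> real measure set" where
  "D_Delta c = {F. real_distribution F \<and> almost_decreasing (local_prob c F)}"

end

theory Submission
  imports Defs
begin

text \<open>
  Write \<open>f x = F(x + \<Delta>)\<close> and let \<open>X\<close>, \<open>Y\<close> be independent with distributions \<open>G1\<close>, \<open>G2\<close>. The idea is the
  single big jump: a sum landing far to the right does so because exactly one of the summands is
  large. For a level \<open>A\<close> and \<open>x \<ge> 2 * A\<close>, the event \<open>X + Y \<in> x + \<Delta>\<close> is the disjoint union of its parts with
  \<open>X \<le> A\<close>, with \<open>Y \<le> A\<close>, and with both summands above \<open>A\<close> (\<open>local_prob_convolution_split\<close>).

  On \<open>X \<le> A\<close> the probability is the integral of \<open>G2(x - u + \<Delta>)\<close> over \<open>u \<le> A\<close> against \<open>G1\<close>. Divided by \<open>f x\<close>,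
  the integrand tends to \<open>c2\<close> for each fixed \<open>u\<close>, because \<open>f\<close> is long-tailed, and it is bounded uniformly
  in \<open>u \<le> A\<close>, because \<open>f\<close> is almost decreasing; dominated convergence gives the limit \<open>c2 * G1(-\<infinity>, A]\<close>
  (\<open>joint_local_prob_ratio_tendsto\<close>). Symmetrically, \<open>Y \<le> A\<close> contributes \<open>c1 * G2(-\<infinity>, A]\<close>.

  It remains to see that two large summands are negligible, in the sense that their contribution,
  divided by \<open>f x\<close>, vanishes if first \<open>x\<close> and then \<open>A\<close> tends to infinity. Far out, the local probabilities of \<open>G1\<close> and \<open>G2\<close>
  are at most constant multiples of those of \<open>F\<close>. Conditioning on one summand at a time lets \<open>F\<close> replace
  first one distribution and then the other, at the price of lowering the level \<open>A\<close> by \<open>c\<close>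
  (\<open>joint_tail_le_dominating_joint_tail\<close>). For two copies of \<open>F\<close> the contribution is known by
  subtraction: subexponentiality says that the whole is \<open>2 * f\<close> asymptotically, and the two parts with a
  small summand are covered by the first step. What is left is \<open>2 - 2 * F(-\<infinity>, A]\<close>
  (\<open>joint_tail_ratio_tendsto\<close>), which tends to \<open>0\<close> as \<open>A\<close> grows.

  For the second claim, \<open>G = G1 * G2\<close> now satisfies \<open>G(x + \<Delta>) / f x \<longlonglongrightarrow> c1 + c2 > 0\<close>, so it inherits the long
  tail of \<open>f\<close>, and the first claim applied to the pair \<open>G\<close>, \<open>G\<close> shows that it is subexponential.
\<close>

section \<open>Local probabilities of a sum with restricted summands\<close>

definition joint_local_prob ::
    "real \<Rightarrow> real measure \<Rightarrow> real measure \<Rightarrow> real set \<Rightarrow> real set \<Rightarrow> real \<Rightarrow> real" where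
  "joint_local_prob c M N U V x =
     measure (M \<Otimes>\<^sub>M N) {p. fst p \<in> U \<and> snd p \<in> V \<and> x < fst p + snd p \<and> fst p + snd p \<le> x + c}"

lemma sets_sum_event:
  fixes U V :: "real set"
  assumes "U \<in> sets borel" "V \<in> sets borel" "sets M = sets borel" "sets N = sets borel"
  shows "{p. fst p \<in> U \<and> snd p \<in> V \<and> x < fst p + snd p \<and> fst p + snd p \<le> x + c} \<in> sets (M \<Otimes>\<^sub>M N)"
proof -
  note [measurable] = assms(1,2)
  have "Measurable.pred (borel \<Otimes>\<^sub>M borel)
      (\<lambda>p. fst p \<in> U \<and> snd p \<in> V \<and> x < fst p + snd p \<and> fst p + snd p \<le> x + c)"
    by measurable
  moreover have "sets (M \<Otimes>\<^sub>M N) = sets (borel \<Otimes>\<^sub>M borel)"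
    using assms by (intro sets_pair_measure_cong) auto
  ultimately show ?thesis
    by (simp add: pred_def space_pair_measure)
qed

lemma joint_local_prob_nonneg: "0 \<le> joint_local_prob c M N U V x"
  by (simp add: joint_local_prob_def)

lemma joint_local_prob_mono:
  assumes "real_distribution M" "real_distribution N"
    and "U' \<in> sets borel" "V' \<in> sets borel"
    and "\<And>u v. u \<in> U \<Longrightarrow> v \<in> V \<Longrightarrow> x < u + v \<Longrightarrow> u + v \<le> x + c \<Longrightarrow> u \<in> U' \<and> v \<in> V'"
  shows "joint_local_prob c M N U V x \<le> joint_local_prob c M N U' V' x"
proof -
  interpret M: real_distribution M by fact
  interpret N: real_distribution N by fact
  interpret P: pair_prob_space M N ..
  show ?thesis
    unfolding joint_local_prob_def
    using assms(3-5) by (intro P.finite_measure_mono sets_sum_event) auto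
qed

lemma joint_local_prob_swap:
  assumes "real_distribution M" "real_distribution N" "U \<in> sets borel" "V \<in> sets borel"
  shows "joint_local_prob c M N U V x = joint_local_prob c N M V U x"
proof -
  interpret M: real_distribution M by fact
  interpret N: real_distribution N by fact
  interpret P: pair_prob_space M N ..
  have "joint_local_prob c M N U V x = measure (distr (N \<Otimes>\<^sub>M M) (M \<Otimes>\<^sub>M N) (\<lambda>(x, y). (y, x)))
      {p. fst p \<in> U \<and> snd p \<in> V \<and> x < fst p + snd p \<and> fst p + snd p \<le> x + c}"
    by (simp add: joint_local_prob_def P.distr_pair_swap[symmetric])
  also have "\<dots> = joint_local_prob c N M V U x"
    unfolding joint_local_prob_def using assms(3,4)
    by (subst measure_distr[OF measurable_pair_swap' sets_sum_event])
       (auto intro!: arg_cong2[where f = measure] simp: space_pair_measure add.commute)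
  finally show ?thesis .
qed

lemma borel_measurable_local_prob:
  assumes "real_distribution M" "0 \<le> c"
  shows "local_prob c M \<in> borel_measurable borel"
proof -
  interpret M: real_distribution M by fact
  have [measurable]: "cdf M \<in> borel_measurable borel"
    by (intro borel_measurable_mono monoI M.cdf_nondecreasing)
  have "local_prob c M = (\<lambda>x. cdf M (x + c) - cdf M x)"
  proof
    fix x show "local_prob c M x = cdf M (x + c) - cdf M x"
      using M.cdf_diff_eq[of x "x + c"] assms(2) by (cases "c = 0") (auto simp: local_prob_def)
  qed
  then show ?thesis by simp
qed

lemma local_prob_nonneg: "0 \<le> local_prob c M x"
  by (simp add: local_prob_def)

text \<open>Conditioning on the first summand: if \<open>X = u\<close>, then \<open>X + Y \<in> x + \<Delta>\<close> means \<open>Y \<in> (x - u) + \<Delta>\<close>.\<close>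

lemma joint_local_prob_eq_integral:
  assumes "real_distribution M" "real_distribution N" "U \<in> sets borel" "0 \<le> c"
  shows "joint_local_prob c M N U UNIV x = (\<integral>u. indicator U u * local_prob c N (x - u) \<partial>M)"
    and "integrable M (\<lambda>u. indicator U u * local_prob c N (x - u))"
proof -
  interpret M: real_distribution M by fact
  interpret N: real_distribution N by fact
  interpret P: pair_prob_space M N ..
  note [measurable] = assms(3) borel_measurable_local_prob[OF assms(2,4)]
  have meas: "(\<lambda>u. indicator U u * local_prob c N (x - u)) \<in> borel_measurable M"
    by simp
  show int: "integrable M (\<lambda>u. indicator U u * local_prob c N (x - u))"
    by (rule M.integrable_const_bound[where B = 1, OF _ meas])
       (auto simp: local_prob_def indicator_def)
  let ?E = "{p. fst p \<in> U \<and> snd p \<in> UNIV \<and> x < fst p + snd p \<and> fst p + snd p \<le> x + c}"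
  have "emeasure (M \<Otimes>\<^sub>M N) ?E = (\<integral>\<^sup>+u. emeasure N (Pair u -` ?E) \<partial>M)"
    by (intro N.emeasure_pair_measure_alt sets_sum_event) auto
  also have "\<dots> = (\<integral>\<^sup>+u. ennreal (indicator U u * local_prob c N (x - u)) \<partial>M)"
  proof (intro nn_integral_cong)
    fix u
    have "Pair u -` ?E = (if u \<in> U then {x - u<..x - u + c} else {})"
      by (auto simp: algebra_simps)
    then show "emeasure N (Pair u -` ?E) = ennreal (indicator U u * local_prob c N (x - u))"
      by (simp add: local_prob_def N.emeasure_eq_measure)
  qed
  also have "\<dots> = ennreal (\<integral>u. indicator U u * local_prob c N (x - u) \<partial>M)"
    by (intro nn_integral_eq_integral int) (auto simp: local_prob_nonneg)
  finally show "joint_local_prob c M N U UNIV x = (\<integral>u. indicator U u * local_prob c N (x - u) \<partial>M)"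
    unfolding joint_local_prob_def
    by (simp add: P.emeasure_eq_measure local_prob_nonneg integral_nonneg_AE)
qed

lemma real_distribution_convolution:
  assumes "real_distribution M" "real_distribution N"
  shows "real_distribution (M \<star> N)"
proof -
  interpret M: real_distribution M by fact
  interpret N: real_distribution N by fact
  interpret P: pair_prob_space M N ..
  have "(\<lambda>(x, y). x + y) \<in> borel_measurable (M \<Otimes>\<^sub>M N)"
    by simp
  then show ?thesis
    unfolding convolution_def by (rule P.real_distribution_distr)
qed

lemma local_prob_convolution:
  assumes "real_distribution M" "real_distribution N"
  shows "local_prob c (M \<star> N) x = joint_local_prob c M N UNIV UNIV x"
proof -
  interpret M: real_distribution M by fact
  interpret N: real_distribution N by fact
  show ?thesis
    unfolding local_prob_def joint_local_prob_def convolution_def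
    by (subst measure_distr)
       (auto intro!: arg_cong2[where f = measure] simp: space_pair_measure)
qed

text \<open>The lower bound on \<open>x\<close> makes the first two events disjoint: two summands of at most \<open>A\<close> cannot have
  a sum above \<open>x\<close>. The second term is written with the summands exchanged, so that the restricted
  one comes first and the integral formula applies to both terms.\<close>

lemma local_prob_convolution_split:
  assumes "real_distribution M" "real_distribution N" "2 * A \<le> x"
  shows "local_prob c (M \<star> N) x =
    joint_local_prob c M N {..A} UNIV x + joint_local_prob c N M {..A} UNIV x
      + joint_local_prob c M N {A<..} {A<..} x"
proof -
  interpret M: real_distribution M by fact
  interpret N: real_distribution N by fact
  interpret P: pair_prob_space M N ..
  let ?E = "\<lambda>U V. {p. fst p \<in> U \<and> snd p \<in> V \<and> x < fst p + snd p \<and> fst p + snd p \<le> x + c}"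
  have sets: "?E U V \<in> sets (M \<Otimes>\<^sub>M N)" if "U \<in> sets borel" "V \<in> sets borel" for U V
    using that by (intro sets_sum_event) auto
  have "?E UNIV UNIV = (?E {..A} UNIV \<union> ?E UNIV {..A}) \<union> ?E {A<..} {A<..}"
    by auto
  moreover have "measure (M \<Otimes>\<^sub>M N) ((?E {..A} UNIV \<union> ?E UNIV {..A}) \<union> ?E {A<..} {A<..}) =
    measure (M \<Otimes>\<^sub>M N) (?E {..A} UNIV \<union> ?E UNIV {..A}) + measure (M \<Otimes>\<^sub>M N) (?E {A<..} {A<..})"
    by (intro P.finite_measure_Union sets.Un sets) auto
  moreover have "measure (M \<Otimes>\<^sub>M N) (?E {..A} UNIV \<union> ?E UNIV {..A}) =
    measure (M \<Otimes>\<^sub>M N) (?E {..A} UNIV) + measure (M \<Otimes>\<^sub>M N) (?E UNIV {..A})"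
    using assms(3) by (intro P.finite_measure_Union sets) auto
  ultimately show ?thesis
    using joint_local_prob_swap[OF assms(1,2), of UNIV "{..A}" c x]
    by (simp add: local_prob_convolution[OF assms(1,2)] joint_local_prob_def)
qed

section \<open>Comparison of joint tails\<close>

text \<open>The integral formula needs the second summand to be unrestricted. On the event, \<open>v > B\<close> forces
  \<open>u < x - B + c\<close>, so the restriction on \<open>v\<close> may be traded for one on \<open>u\<close>. All arguments \<open>x - u\<close> that
  occur are then above \<open>B - c\<close>, where the two local probabilities are comparable. Trading back,
  \<open>v > x - u > B - c\<close>, which is where the level drops by \<open>c\<close>.\<close>

lemma joint_local_prob_replace_second:
  assumes "real_distribution M" "real_distribution N" "real_distribution F" "0 \<le> c" 
    and K: "\<And>y. y > B - c \<Longrightarrow> local_prob c N y \<le> K * local_prob c F y"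
    and "0 \<le> K"
  shows "joint_local_prob c M N {A<..} {B<..} x \<le> K * joint_local_prob c M F {A<..} {B - c<..} x"
proof -
  let ?U = "{A<..} \<inter> {..<x - B + c}"
  have "joint_local_prob c M N {A<..} {B<..} x \<le> joint_local_prob c M N ?U UNIV x"
    using assms by (intro joint_local_prob_mono) auto
  also have "\<dots> = (\<integral>u. indicator ?U u * local_prob c N (x - u) \<partial>M)"
    using assms by (intro joint_local_prob_eq_integral) auto
  also have "\<dots> \<le> (\<integral>u. K * (indicator ?U u * local_prob c F (x - u)) \<partial>M)"
    using assms
    by (intro integral_mono integrable_mult_right joint_local_prob_eq_integral(2))
       (auto simp: indicator_def intro!: K)
  also have "\<dots> = K * joint_local_prob c M F ?U UNIV x"
    using assms by (subst joint_local_prob_eq_integral(1)) auto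
  also have "\<dots> \<le> K * joint_local_prob c M F {A<..} {B - c<..} x"
    using assms by (intro mult_left_mono joint_local_prob_mono) auto
  finally show ?thesis .
qed

lemma joint_tail_le_dominating_joint_tail:
  assumes "real_distribution M" "real_distribution N" "real_distribution F" "0 \<le> c"
    and "\<And>y. y > A - c \<Longrightarrow> local_prob c M y \<le> K * local_prob c F y"
    and "\<And>y. y > A - c \<Longrightarrow> local_prob c N y \<le> L * local_prob c F y"
    and "0 \<le> K" "0 \<le> L"
  shows "joint_local_prob c M N {A<..} {A<..} x
    \<le> K * L * joint_local_prob c F F {A - c<..} {A - c<..} x"
proof -
  have "joint_local_prob c M N {A<..} {A<..} x \<le> L * joint_local_prob c M F {A<..} {A - c<..} x"
    using assms by (intro joint_local_prob_replace_second) auto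
  also have "\<dots> = L * joint_local_prob c F M {A - c<..} {A<..} x"
    using assms by (subst joint_local_prob_swap) auto
  also have "\<dots> \<le> L * (K * joint_local_prob c F F {A - c<..} {A - c<..} x)"
    using assms by (intro mult_left_mono joint_local_prob_replace_second) auto
  finally show ?thesis by (simp add: ac_simps)
qed

section \<open>Ratios to a long-tailed function\<close>

text \<open>The definition of a long tail speaks only of shifts in one direction; the other direction
  follows by substitution and taking inverses.\<close>

lemma long_tailed_shift_tendsto:
  assumes f: "f \<in> long_tailed_fun"
  shows "((\<lambda>x. f (x - u) / f x) \<longlongrightarrow> 1) at_top"
proof -
  from f obtain x0 where x0: "\<And>x. x \<ge> x0 \<Longrightarrow> 0 < f x"
    and eq: "\<And>y. y > 0 \<Longrightarrow> (\<lambda>x. f (x + y)) \<sim>[at_top] f"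
    by (auto simp: long_tailed_fun_def)
  have nz: "eventually (\<lambda>x. f x \<noteq> 0) at_top"
    using eventually_ge_at_top[of x0] by eventually_elim (use x0 in force)
  have plus: "((\<lambda>x. f (x + y) / f x) \<longlongrightarrow> 1) at_top" if "y > 0" for y
    using nz by (intro asymp_equivD_strong eq that) (auto elim: eventually_mono)
  consider "u < 0" | "u = 0" | "u > 0" by linarith
  then show ?thesis
  proof cases
    case 1 then show ?thesis using plus[of "- u"] by simp
  next
    case 2 then show ?thesis
      using nz by (intro tendsto_eventually) (auto elim: eventually_mono)
  next
    case 3
    have "filterlim (\<lambda>x::real. x - u) at_top at_top"
      using filterlim_tendsto_add_at_top[OF tendsto_const[of "-u"] filterlim_ident] by simp
    from filterlim_compose[OF plus[OF 3] this]
    have "((\<lambda>x. f x / f (x - u)) \<longlongrightarrow> 1) at_top" by simp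
    from tendsto_inverse[OF this] show ?thesis by (simp add: inverse_eq_divide)
  qed
qed

lemma ratio_tendsto_imp_bound:
  assumes "((\<lambda>x. g x / f x) \<longlongrightarrow> (b::real)) at_top" "eventually (\<lambda>x::real. 0 < f x) at_top" "0 \<le> b"
  obtains K x1 where "0 \<le> K" "\<And>x. x > x1 \<Longrightarrow> g x \<le> K * f x"
proof -
  have "eventually (\<lambda>x. g x / f x < b + 1) at_top"
    using assms(1) by (rule order_tendstoD) simp
  with assms(2) have "eventually (\<lambda>x. g x \<le> (b + 1) * f x) at_top"
    by eventually_elim (simp add: divide_simps)
  then obtain x1 where "\<And>x. x > x1 \<Longrightarrow> g x \<le> (b + 1) * f x"
    by (auto simp: eventually_at_top_dense)
  then show ?thesis using assms(3) by (intro that[of "b + 1" x1]) auto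
qed

text \<open>Dominated convergence in the integral formula. The integrable bound is the point where almost
  decreasing is used: as \<open>u\<close> ranges over all of \<open>{..A}\<close>, the argument \<open>x - u\<close> is unbounded to the right of
  \<open>x - A\<close>, so \<open>f (x - u)\<close> has to be controlled by \<open>f (x - A)\<close>, which is comparable with \<open>f x\<close>.\<close>

lemma joint_local_prob_ratio_tendsto:
  assumes M: "real_distribution M" and N: "real_distribution N" and c: "0 \<le> c"
    and f: "f \<in> long_tailed_fun" and dec: "almost_decreasing f"
    and lim: "((\<lambda>x. local_prob c N x / f x) \<longlongrightarrow> b) at_top" and b: "0 \<le> b"
  shows "((\<lambda>x. joint_local_prob c M N {..A} UNIV x / f x) \<longlongrightarrow> b * measure M {..A}) at_top"
proof -
  interpret M: real_distribution M by fact
  note [measurable] = borel_measurable_local_prob[OF N c]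
  from f have pos: "eventually (\<lambda>x. 0 < f x) at_top"
    by (auto simp: long_tailed_fun_def eventually_at_top_linorder)
  from f have nonneg: "0 \<le> f x" for x
    by (simp add: long_tailed_fun_def)
  obtain C x1 where C: "0 \<le> C" "\<And>x. x > x1 \<Longrightarrow> local_prob c N x \<le> C * f x"
    using ratio_tendsto_imp_bound[OF lim pos b] by blast
  from dec obtain x0 K where K: "K > 0" "\<And>x y. x > x0 \<Longrightarrow> y > 0 \<Longrightarrow> f (x + y) \<le> K * f x"
    unfolding almost_decreasing_def by blast
  have shift: "((\<lambda>x. f (x - u) / f x) \<longlongrightarrow> 1) at_top" for u
    by (rule long_tailed_shift_tendsto[OF f])
  have ptw: "((\<lambda>x. local_prob c N (x - u) / f x) \<longlongrightarrow> b) at_top" for u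
  proof -
    have top: "filterlim (\<lambda>x::real. x - u) at_top at_top"
      using filterlim_tendsto_add_at_top[OF tendsto_const[of "-u"] filterlim_ident] by simp
    have "((\<lambda>x. local_prob c N (x - u) / f (x - u) * (f (x - u) / f x)) \<longlongrightarrow> b * 1) at_top"
      by (intro tendsto_mult filterlim_compose[OF lim top] shift)
    moreover have "eventually (\<lambda>x. local_prob c N (x - u) / f (x - u) * (f (x - u) / f x)
        = local_prob c N (x - u) / f x) at_top"
      using filterlim_iff[THEN iffD1, OF top, rule_format, OF pos] by eventually_elim simp
    ultimately have "((\<lambda>x. local_prob c N (x - u) / f x) \<longlongrightarrow> b * 1) at_top"
      by (rule Lim_transform_eventually)
    then show ?thesis by simp
  qed
  have bound: "eventually (\<lambda>x. AE u in M.
      norm (indicator {..A} u * (local_prob c N (x - u) / f x)) \<le> C * (max K 1 * 2)) at_top"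
  proof -
    have "eventually (\<lambda>x. f (x - A) / f x < 2) at_top"
      by (rule order_tendstoD[OF shift]) simp
    with pos eventually_gt_at_top[of "A + x0"] eventually_gt_at_top[of "A + x1"]
    show ?thesis
    proof eventually_elim
      case (elim x)
      have "local_prob c N (x - u) / f x \<le> C * (max K 1 * 2)" if "u \<le> A" for u
      proof -
        \<comment> \<open>The maximum covers \<open>u = A\<close>, since almost decreasing concerns positive increments only.\<close>
        have "f (x - u) \<le> max K 1 * f (x - A)"
        proof (cases "u = A")
          case True
          then show ?thesis using mult_right_mono[of 1 "max K 1" "f (x - A)"] nonneg by simp
        next
          case False
          then have "f ((x - A) + (A - u)) \<le> K * f (x - A)"
            using that elim by (intro K) auto
          also have "\<dots> \<le> max K 1 * f (x - A)"
            by (intro mult_right_mono nonneg) simp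
          finally show ?thesis by simp
        qed
        also have "\<dots> \<le> max K 1 * (2 * f x)"
          using elim by (intro mult_left_mono) (auto simp: divide_simps)
        finally have "C * f (x - u) \<le> C * (max K 1 * (2 * f x))"
          using C(1) by (rule mult_left_mono)
        moreover have "local_prob c N (x - u) \<le> C * f (x - u)"
          using that elim by (intro C(2)) auto
        ultimately show ?thesis
          using elim by (simp add: divide_simps ac_simps)
      qed
      moreover have "0 \<le> C * (max K 1 * 2)"
        using C(1) by simp
      ultimately show ?case
        using elim by (intro AE_I2) (auto simp: indicator_def local_prob_nonneg abs_mult)
    qed
  qed
  have "((\<lambda>x. \<integral>u. indicator {..A} u * (local_prob c N (x - u) / f x) \<partial>M)
      \<longlongrightarrow> (\<integral>u. indicator {..A} u * b \<partial>M)) at_top"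
  proof (rule integral_dominated_convergence_at_top[where w = "\<lambda>_. C * (max K 1 * 2)"])
    show "AE u in M. ((\<lambda>x. indicator {..A} u * (local_prob c N (x - u) / f x))
        \<longlongrightarrow> indicator {..A} u * b) at_top"
      by (intro AE_I2 tendsto_mult tendsto_const ptw)
  qed (use bound in auto)
  also have "(\<integral>u. indicator {..A} u * b \<partial>M) = b * measure M {..A}"
    by simp
  also have "(\<lambda>x. \<integral>u. indicator {..A} u * (local_prob c N (x - u) / f x) \<partial>M)
      = (\<lambda>x. joint_local_prob c M N {..A} UNIV x / f x)"
    using M N c by (subst joint_local_prob_eq_integral(1)) auto
  finally show ?thesis .
qed

section \<open>Convolutions\<close>

text \<open>Subexponentiality gives the limit \<open>2\<close> for the whole convolution, and each of the two parts with one
  summand at most \<open>B\<close> takes away \<open>cdf F B\<close>.\<close>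

lemma joint_tail_ratio_tendsto:
  assumes F: "F \<in> S_Delta c" "F \<in> D_Delta c" and c: "0 < c"
  shows "((\<lambda>x. joint_local_prob c F F {B<..} {B<..} x / local_prob c F x)
    \<longlongrightarrow> 2 - 2 * cdf F B) at_top"
proof -
  let ?f = "local_prob c F"
  let ?J = "joint_local_prob c F F"
  from F have RF: "real_distribution F" and f: "?f \<in> long_tailed_fun"
    and conv: "local_prob c (F \<star> F) \<sim>[at_top] (\<lambda>x. 2 * ?f x)"
    and dec: "almost_decreasing ?f"
    by (auto simp: S_Delta_def L_Delta_def D_Delta_def)
  from f have nz: "eventually (\<lambda>x. ?f x \<noteq> 0) at_top"
    by (force simp: long_tailed_fun_def eventually_at_top_linorder)
  have one: "((\<lambda>x. ?f x / ?f x) \<longlongrightarrow> 1) at_top"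
    using long_tailed_shift_tendsto[OF f, of 0] by simp
  have two: "((\<lambda>x. 2 * (local_prob c (F \<star> F) x / (2 * ?f x))) \<longlongrightarrow> 2 * 1) at_top"
    by (intro tendsto_mult tendsto_const asymp_equivD_strong[OF conv] eventually_mono[OF nz]) auto
  have low: "((\<lambda>x. ?J {..B} UNIV x / ?f x) \<longlongrightarrow> 1 * cdf F B) at_top"
    unfolding cdf_def
    using RF c f dec one by (intro joint_local_prob_ratio_tendsto) auto
  have "((\<lambda>x. 2 * (local_prob c (F \<star> F) x / (2 * ?f x)) - 2 * (?J {..B} UNIV x / ?f x))
      \<longlongrightarrow> 2 * 1 - 2 * (1 * cdf F B)) at_top"
    by (intro tendsto_diff two tendsto_mult tendsto_const low)
  moreover have "eventually (\<lambda>x. 2 * (local_prob c (F \<star> F) x / (2 * ?f x))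
      - 2 * (?J {..B} UNIV x / ?f x) = ?J {B<..} {B<..} x / ?f x) at_top"
    using nz eventually_ge_at_top[of "2 * B"]
  proof eventually_elim
    case (elim x)
    then show ?case
      using local_prob_convolution_split[OF RF RF, of B x c] by (simp add: field_simps)
  qed
  ultimately have "((\<lambda>x. ?J {B<..} {B<..} x / ?f x) \<longlongrightarrow> 2 * 1 - 2 * (1 * cdf F B)) at_top"
    by (rule Lim_transform_eventually)
  then show ?thesis by simp
qed

text \<open>For each large level \<open>A\<close> the ratio is eventually between functions of \<open>x\<close> converging to \<open>?lo A\<close> and \<open>?hi A\<close>,
  and both of these limits tend to \<open>a + b\<close> as \<open>A\<close> grows. The order of the two limits matters: \<open>A\<close> is chosen
  first, according to the desired accuracy, and then \<open>x\<close> tends to infinity.\<close>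

lemma local_prob_convolution_ratio_tendsto:
  assumes c: "0 < c" and F: "F \<in> S_Delta c" "F \<in> D_Delta c"
    and M: "real_distribution M" and N: "real_distribution N"
    and a: "0 \<le> a" and b: "0 \<le> b"
    and limM: "((\<lambda>x. local_prob c M x / local_prob c F x) \<longlongrightarrow> a) at_top"
    and limN: "((\<lambda>x. local_prob c N x / local_prob c F x) \<longlongrightarrow> b) at_top"
  shows "((\<lambda>x. local_prob c (M \<star> N) x / local_prob c F x) \<longlongrightarrow> a + b) at_top"
proof -
  let ?f = "local_prob c F"
  from F have RF: "real_distribution F" and f: "?f \<in> long_tailed_fun"
    and dec: "almost_decreasing ?f"
    by (auto simp: S_Delta_def L_Delta_def D_Delta_def)
  interpret F: real_distribution F by fact
  interpret M: real_distribution M by fact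
  interpret N: real_distribution N by fact
  from f have pos: "eventually (\<lambda>x. 0 < ?f x) at_top"
    by (auto simp: long_tailed_fun_def eventually_at_top_linorder)
  obtain K x1 where K: "0 \<le> K" "\<And>x. x > x1 \<Longrightarrow> local_prob c M x \<le> K * ?f x"
    using ratio_tendsto_imp_bound[OF limM pos a] by blast
  obtain L x2 where L: "0 \<le> L" "\<And>x. x > x2 \<Longrightarrow> local_prob c N x \<le> L * ?f x"
    using ratio_tendsto_imp_bound[OF limN pos b] by blast
  let ?low = "\<lambda>A x. joint_local_prob c M N {..A} UNIV x / ?f x + joint_local_prob c N M {..A} UNIV x / ?f x"
  let ?lo = "\<lambda>A. b * cdf M A + a * cdf N A"
  let ?tail = "\<lambda>A x. joint_local_prob c F F {A - c<..} {A - c<..} x / ?f x"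
  let ?hi = "\<lambda>A. ?lo A + K * L * (2 - 2 * cdf F (A - c))"
  have low: "(?low A \<longlongrightarrow> ?lo A) at_top" for A
    unfolding cdf_def using M N c f dec limM limN a b
    by (intro tendsto_add joint_local_prob_ratio_tendsto) auto
  have tail: "(?tail A \<longlongrightarrow> 2 - 2 * cdf F (A - c)) at_top" for A
    by (rule joint_tail_ratio_tendsto[OF F c])
  have high: "((\<lambda>x. ?low A x + K * L * ?tail A x) \<longlongrightarrow> ?hi A) at_top" for A
    by (intro tendsto_add tendsto_mult tendsto_const low tail)
  have sandwich: "eventually (\<lambda>x. ?low A x \<le> local_prob c (M \<star> N) x / ?f x \<and>
      local_prob c (M \<star> N) x / ?f x \<le> ?low A x + K * L * ?tail A x) at_top"
    if A: "A - c \<ge> x1" "A - c \<ge> x2" for A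
    using pos eventually_ge_at_top[of "2 * A"]
  proof eventually_elim
    case (elim x)
    let ?T = "joint_local_prob c M N {A<..} {A<..} x"
    have eq: "local_prob c (M \<star> N) x / ?f x = ?low A x + ?T / ?f x"
      using local_prob_convolution_split[OF M N, of A x c] elim by (simp add: add_divide_distrib)
    have "?T \<le> K * L * joint_local_prob c F F {A - c<..} {A - c<..} x"
      using M N RF c K L A by (intro joint_tail_le_dominating_joint_tail) auto
    then have "?T / ?f x \<le> K * L * ?tail A x"
      using elim by (simp add: divide_simps)
    moreover have "0 \<le> ?T / ?f x"
      by (simp add: joint_local_prob_nonneg local_prob_nonneg)
    ultimately show ?case by (simp add: eq)
  qed
  have lo_lim: "(?lo \<longlongrightarrow> b * 1 + a * 1) at_top"
    by (intro tendsto_add tendsto_mult tendsto_const M.cdf_lim_at_top_prob N.cdf_lim_at_top_prob)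
  have top: "filterlim (\<lambda>A::real. A - c) at_top at_top"
    using filterlim_tendsto_add_at_top[OF tendsto_const[of "-c"] filterlim_ident] by simp
  have hi_lim: "(?hi \<longlongrightarrow> (b * 1 + a * 1) + K * L * (2 - 2 * 1)) at_top"
    by (intro tendsto_add[OF lo_lim] tendsto_mult tendsto_diff tendsto_const
        filterlim_compose[OF F.cdf_lim_at_top_prob top])
  have A_large: "eventually (\<lambda>A. A - c \<ge> x1 \<and> A - c \<ge> x2) at_top"
    using eventually_ge_at_top[of "x1 + c"] eventually_ge_at_top[of "x2 + c"]
    by eventually_elim auto
  show ?thesis
  proof (rule order_tendstoI)
    fix r assume r: "r < a + b"
    have "eventually (\<lambda>A. r < ?lo A) at_top"
      using r by (intro order_tendstoD(1)[OF lo_lim]) auto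
    from eventually_happens'[OF _ eventually_conj[OF this A_large]]
    obtain A where A: "r < ?lo A" "A - c \<ge> x1" "A - c \<ge> x2" by auto
    from order_tendstoD(1)[OF low A(1)] sandwich[OF A(2,3)]
    show "eventually (\<lambda>x. r < local_prob c (M \<star> N) x / ?f x) at_top"
      by eventually_elim auto
  next
    fix r assume r: "a + b < r"
    have "eventually (\<lambda>A. ?hi A < r) at_top"
      using r by (intro order_tendstoD(2)[OF hi_lim]) auto
    from eventually_happens'[OF _ eventually_conj[OF this A_large]]
    obtain A where A: "?hi A < r" "A - c \<ge> x1" "A - c \<ge> x2" by auto
    from order_tendstoD(2)[OF high A(1)] sandwich[OF A(2,3)]
    show "eventually (\<lambda>x. local_prob c (M \<star> N) x / ?f x < r) at_top"
      by eventually_elim auto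
  qed
qed

text \<open>The long tail is inherited through \<open>G(x + \<Delta>) \<sim> d * F(x + \<Delta>)\<close>. Subexponentiality of \<open>G\<close> is the
  previous lemma for two copies of \<open>G\<close>, with the limit \<open>d + d\<close>.\<close>

lemma S_Delta_closed_under_tail_equivalence:
  assumes c: "0 < c" and F: "F \<in> S_Delta c" "F \<in> D_Delta c"
    and G: "real_distribution G" and d: "0 < d"
    and lim: "((\<lambda>x. local_prob c G x / local_prob c F x) \<longlongrightarrow> d) at_top"
  shows "G \<in> S_Delta c"
proof -
  let ?f = "local_prob c F" and ?g = "local_prob c G"
  from F have f: "?f \<in> long_tailed_fun"
    by (auto simp: S_Delta_def L_Delta_def)
  from f have posf: "eventually (\<lambda>x. 0 < ?f x) at_top"
    by (auto simp: long_tailed_fun_def eventually_at_top_linorder)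
  have gf: "?g \<sim>[at_top] (\<lambda>x. d * ?f x)"
    using lim d by (intro asymp_equivI'_const) auto
  have "eventually (\<lambda>x. 0 < ?g x / ?f x) at_top"
    using lim d by (rule order_tendstoD)
  with posf have "eventually (\<lambda>x. 0 < ?g x) at_top"
    by eventually_elim (simp add: zero_less_divide_iff)
  then obtain x0 where x0: "\<And>x. x \<ge> x0 \<Longrightarrow> 0 < ?g x"
    by (auto simp: eventually_at_top_linorder)
  have "\<exists>x0>0. \<forall>x\<ge>x0. 0 < ?g x"
    using x0 by (intro exI[of _ "max x0 1"]) auto
  moreover have "(\<lambda>x. ?g (x + y)) \<sim>[at_top] ?g" if y: "y > 0" for y
  proof -
    have top: "filterlim (\<lambda>x::real. x + y) at_top at_top"
      using filterlim_tendsto_add_at_top[OF tendsto_const[of y] filterlim_ident]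
      by (simp add: add.commute)
    have "(\<lambda>x. ?g (x + y)) \<sim>[at_top] (\<lambda>x. d * ?f (x + y))"
      using asymp_equiv_compose[OF gf top] by (simp add: o_def)
    also have "\<dots> \<sim>[at_top] (\<lambda>x. d * ?f x)"
      using f y by (intro asymp_equiv_mult asymp_equiv_refl) (auto simp: long_tailed_fun_def)
    also have "\<dots> \<sim>[at_top] ?g"
      using gf by (rule asymp_equiv_symI)
    finally show ?thesis .
  qed
  moreover have "local_prob c (G \<star> G) \<sim>[at_top] (\<lambda>x. 2 * ?g x)"
  proof -
    have "local_prob c (G \<star> G) \<sim>[at_top] (\<lambda>x. (d + d) * ?f x)"
      using c F G d lim by (intro asymp_equivI'_const local_prob_convolution_ratio_tendsto) auto
    also have "\<dots> = (\<lambda>x. 2 * (d * ?f x))"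
      by auto
    also have "\<dots> \<sim>[at_top] (\<lambda>x. 2 * ?g x)"
      by (intro asymp_equiv_mult asymp_equiv_refl asymp_equiv_symI[OF gf])
    finally show ?thesis .
  qed
  ultimately show ?thesis
    using G c borel_measurable_local_prob[OF G, of c]
    by (auto simp: S_Delta_def L_Delta_def long_tailed_fun_def local_prob_nonneg)
qed

theorem proposition3p8:
  fixes c c1 c2 :: real and F G1 G2 :: "real measure"
  assumes "c > 0"
    and "F \<in> S_Delta c \<inter> D_Delta c"
    and "real_distribution G1" and "real_distribution G2"
    and "c1 \<ge> 0" and "c2 \<ge> 0"
    and "((\<lambda>x. local_prob c G1 x / local_prob c F x) \<longlongrightarrow> c1) at_top"
    and "((\<lambda>x. local_prob c G2 x / local_prob c F x) \<longlongrightarrow> c2) at_top"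
  shows "((\<lambda>x. local_prob c (G1 \<star> G2) x / local_prob c F x) \<longlongrightarrow> c1 + c2) at_top \<and>
    (c1 + c2 > 0 \<longrightarrow> (G1 \<star> G2) \<in> S_Delta c)"
proof -
  have F: "F \<in> S_Delta c" "F \<in> D_Delta c"
    using assms(2) by auto
  have lim: "((\<lambda>x. local_prob c (G1 \<star> G2) x / local_prob c F x) \<longlongrightarrow> c1 + c2) at_top"
    using assms F by (intro local_prob_convolution_ratio_tendsto) auto
  then show ?thesis
    using S_Delta_closed_under_tail_equivalence[OF assms(1) F
        real_distribution_convolution[OF assms(3,4)] _ lim]
    by blast
qed

end
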